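(* Let $h>0$, $\varepsilon>0$, $(\alpha_1,\beta_1)=(\tfrac12,\tfrac18)$, $(\alpha_2,\beta_2)=(1,\tfrac16)$, $j\in\{1,2\}$, $f(u)=\tfrac12u^2$, let $u$ be a given grid function (the stage value) and $D_h$ a discrete first-derivative matrix on a grid of spacing $\Delta x$. Put $$c_j=1+\frac{\alpha_jh}{\varepsilon}+\frac{\beta_jh^2}{\varepsilon^2},\qquad \gamma_j=\frac{\beta_jh^2}{\varepsilon},\qquad M_{v,j}=c_jI-\gamma_j\operatorname{diag}(f'(u))D_h .$$ Preconditioning by the exact local source block $P_j=c_jI$ gives $$P_j^{-1}M_{v,j}=I-\theta_j(\varepsilon)\operatorname{diag}(f'(u))D_h,\qquad \theta_j(\varepsilon)=\frac{\beta_jh^2/\varepsilon}{1+\alpha_jh/\varepsilon+\beta_jh^2/\varepsilon^2},$$ with $$0\le\theta_j(\varepsilon)\le\varepsilon .$$ Hence, if $\|D_h\|\le C_D/\Delta x$, $$\|P_j^{-1}M_{v,j}-I\|\le C_D\,\|f'(u)\|_\infty\,\frac{\varepsilon}{\Delta x}.$$ In particular the family $P_j^{-1}M_{v,j}$ is uniformly bounded when $\varepsilon/\Delta x=O(1)$ and clusters to the identity (converges to $I$ in norm) when $\varepsilon/\Delta x\to0$.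
   Context: $M_{v,j}$ is the operator of the implicit $v$-stage of the compact two-stage method applied to the Jin–Xin relaxation system $u_t+v_x=0$, $v_t+a^2u_x=(f(u)-v)/\varepsilon$; at an implicit stage $u$ is fixed by known data. The matrix norm is an operator norm with $\|\operatorname{diag}(w)\|\le\|w\|_\infty$ (e.g. induced by the discrete $\ell^2$ or $\ell^\infty$ norm). In the asymptotic statements $C_D$ and a bound for $\|f'(u)\|_\infty$ are fixed, independent of $\varepsilon,\Delta x,h$. *)

theory Defs
  imports
    "HOL-Analysis.Derivative"
    "Jordan_Normal_Form.Gauss_Jordan_Elimination"
begin

(* Grid functions on a grid of n points are vectors in carrier_vec n and operators on them are
   matrices in carrier_mat n n, so that the number of grid points may vary along a family. *)

definition flux :: "real \<Rightarrow> real" where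
  "flux s = s\<^sup>2 / 2"

definition dflux :: "real vec \<Rightarrow> real vec" where
  "dflux u = map_vec (deriv flux) u"

definition diag_of :: "real vec \<Rightarrow> real mat" where
  "diag_of w = mat_diag (dim_vec w) (\<lambda>i. vec_index w i)"

(* Only meaningful for vectors of positive dimension. *)
definition sup_norm :: "real vec \<Rightarrow> real" where
  "sup_norm w = Max ((\<lambda>i. \<bar>vec_index w i\<bar>) ` {..<dim_vec w})"

definition is_vec_norm :: "nat \<Rightarrow> (real vec \<Rightarrow> real) \<Rightarrow> bool" where
  "is_vec_norm n N \<longleftrightarrow>
     (\<forall>x\<in>carrier_vec n. 0 \<le> N x \<and> (N x = 0 \<longleftrightarrow> x = 0\<^sub>v n)) \<and>
     (\<forall>c. \<forall>x\<in>carrier_vec n. N (c \<cdot>\<^sub>v x) = \<bar>c\<bar> * N x) \<and>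
     (\<forall>x\<in>carrier_vec n. \<forall>y\<in>carrier_vec n. N (x + y) \<le> N x + N y)"

(* The supremum is over a nonempty set, which is bounded above whenever is_vec_norm n N and
   A is n by n. *)
definition op_norm :: "nat \<Rightarrow> (real vec \<Rightarrow> real) \<Rightarrow> real mat \<Rightarrow> real" where
  "op_norm n N A = Sup {N (A *\<^sub>v x) | x. x \<in> carrier_vec n \<and> N x \<le> 1}"

definition diag_compatible_norm :: "nat \<Rightarrow> (real vec \<Rightarrow> real) \<Rightarrow> bool" where
  "diag_compatible_norm n N \<longleftrightarrow>
     is_vec_norm n N \<and> (\<forall>w\<in>carrier_vec n. op_norm n N (diag_of w) \<le> sup_norm w)"

(* Only the stages j = 1 and j = 2 are meaningful. *)
definition stage_alpha :: "nat \<Rightarrow> real" where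
  "stage_alpha j = (if j = 1 then 1/2 else 1)"

definition stage_beta :: "nat \<Rightarrow> real" where
  "stage_beta j = (if j = 1 then 1/8 else 1/6)"

definition stage_c :: "nat \<Rightarrow> real \<Rightarrow> real \<Rightarrow> real" where
  "stage_c j h \<epsilon> = 1 + stage_alpha j * h / \<epsilon> + stage_beta j * h\<^sup>2 / \<epsilon>\<^sup>2"

definition stage_gamma :: "nat \<Rightarrow> real \<Rightarrow> real \<Rightarrow> real" where
  "stage_gamma j h \<epsilon> = stage_beta j * h\<^sup>2 / \<epsilon>"

definition stage_theta :: "nat \<Rightarrow> real \<Rightarrow> real \<Rightarrow> real" where
  "stage_theta j h \<epsilon> =
     (stage_beta j * h\<^sup>2 / \<epsilon>) / (1 + stage_alpha j * h / \<epsilon> + stage_beta j * h\<^sup>2 / \<epsilon>\<^sup>2)"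

definition stage_M :: "nat \<Rightarrow> nat \<Rightarrow> real \<Rightarrow> real \<Rightarrow> real vec \<Rightarrow> real mat \<Rightarrow> real mat" where
  "stage_M j n h \<epsilon> u D =
     stage_c j h \<epsilon> \<cdot>\<^sub>m 1\<^sub>m n - stage_gamma j h \<epsilon> \<cdot>\<^sub>m (diag_of (dflux u) * D)"

definition stage_P :: "nat \<Rightarrow> nat \<Rightarrow> real \<Rightarrow> real \<Rightarrow> real mat" where
  "stage_P j n h \<epsilon> = stage_c j h \<epsilon> \<cdot>\<^sub>m 1\<^sub>m n"

(* P_j^{-1} M_{v,j}; mat_inverse returns Some inverse exactly for invertible square matrices. *)
definition stage_PM :: "nat \<Rightarrow> nat \<Rightarrow> real \<Rightarrow> real \<Rightarrow> real vec \<Rightarrow> real mat \<Rightarrow> real mat" where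
  "stage_PM j n h \<epsilon> u D = the (mat_inverse (stage_P j n h \<epsilon>)) * stage_M j n h \<epsilon> u D"

(* A discrete first-derivative matrix D enters only through its size and the bound
   C_D / \<Delta>x on its operator norm. *)
definition stage_data ::
  "nat \<Rightarrow> real \<Rightarrow> real \<Rightarrow> real vec \<Rightarrow> real mat \<Rightarrow> bool" where
  "stage_data n h \<epsilon> u D \<longleftrightarrow>
     0 < n \<and> 0 < h \<and> 0 < \<epsilon> \<and> u \<in> carrier_vec n \<and> D \<in> carrier_mat n n"

definition derivative_bound ::
  "real \<Rightarrow> nat \<Rightarrow> (real vec \<Rightarrow> real) \<Rightarrow> real \<Rightarrow> real mat \<Rightarrow> bool" where
  "derivative_bound C\<^sub>D n N \<Delta>x D \<longleftrightarrow> 0 < \<Delta>x \<and> op_norm n N D \<le> C\<^sub>D / \<Delta>x"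

end

theory Submission
  imports Defs "HOL-Analysis.Function_Topology"
begin

text \<open>
  Since \<open>c\<^sub>j \<ge> \<beta>\<^sub>j h\<^sup>2 / \<epsilon>\<^sup>2\<close>, the quotient \<open>\<theta>\<^sub>j = \<gamma>\<^sub>j / c\<^sub>j\<close> is at most \<open>\<epsilon>\<close>, and the norm bounds follow from
  submultiplicativity of the operator norm. The latter needs that every linear map is bounded with
  respect to an arbitrary norm, that is, the equivalence of norms in finite dimension; it comes from
  minimising the norm over the compact faces \<open>x\<^sub>i = 1\<close> of the unit cube.
\<close>

section \<open>Norms on coordinate vectors\<close>

context
  fixes n :: nat and N :: "real vec \<Rightarrow> real"
  assumes norm: "is_vec_norm n N"
begin

lemma vec_norm_nonneg: "x \<in> carrier_vec n \<Longrightarrow> 0 \<le> N x"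
  using norm unfolding is_vec_norm_def by blast

lemma vec_norm_eq_0_iff: "x \<in> carrier_vec n \<Longrightarrow> N x = 0 \<longleftrightarrow> x = 0\<^sub>v n"
  using norm unfolding is_vec_norm_def by blast

lemma vec_norm_smult: "x \<in> carrier_vec n \<Longrightarrow> N (c \<cdot>\<^sub>v x) = \<bar>c\<bar> * N x"
  using norm unfolding is_vec_norm_def by blast

lemma vec_norm_triangle: "x \<in> carrier_vec n \<Longrightarrow> y \<in> carrier_vec n \<Longrightarrow> N (x + y) \<le> N x + N y"
  using norm unfolding is_vec_norm_def by blast

lemma vec_norm_uminus:
  assumes "x \<in> carrier_vec n"
  shows "N (- x) = N x"
proof -
  have "- x = (-1) \<cdot>\<^sub>v x" using assms by auto
  then show ?thesis using vec_norm_smult[OF assms, of "-1"] by simp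
qed

lemma vec_norm_diff_triangle:
  assumes x: "x \<in> carrier_vec n" and y: "y \<in> carrier_vec n"
  shows "N (x - y) \<le> N x + N y"
proof -
  have "x - y = x + (- y)" using x y by auto
  then show ?thesis
    using vec_norm_triangle[of x "- y"] vec_norm_uminus[OF y] x y by simp
qed

lemma vec_norm_reverse_triangle:
  assumes x: "x \<in> carrier_vec n" and y: "y \<in> carrier_vec n"
  shows "\<bar>N x - N y\<bar> \<le> N (x - y)"
proof -
  have "x = (x - y) + y" "y = x - (x - y)" using x y by auto
  then have "N x \<le> N (x - y) + N y" "N y \<le> N x + N (x - y)"
    using vec_norm_triangle[of "x - y" y] vec_norm_diff_triangle[of x "x - y"] x y
    by (metis minus_carrier_vec)+
  then show ?thesis by linarith
qed

section \<open>Equivalence of an arbitrary norm with the coordinates\<close>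

lemma vec_norm_le_sum_units:
  assumes x: "x \<in> carrier_vec n"
  shows "N x \<le> (\<Sum>i<n. \<bar>vec_index x i\<bar> * N (unit_vec n i))"
proof -
  \<comment> \<open>\<open>y k\<close> is \<open>x\<close> cut off after its first k coordinates, so
    the induction adds one multiple of a unit vector at a time on the way from the zero vector to
    \<open>x\<close>.\<close>
  define y where "y k = vec n (\<lambda>i. if i < k then vec_index x i else 0)" for k
  have "N (y k) \<le> (\<Sum>i<k. \<bar>vec_index x i\<bar> * N (unit_vec n i))" if "k \<le> n" for k
    using that
  proof (induction k)
    case 0
    have "y 0 = 0\<^sub>v n" unfolding y_def by auto
    then show ?case using vec_norm_eq_0_iff[of "0\<^sub>v n"] by simp
  next
    case (Suc k)
    have "y (Suc k) = y k + vec_index x k \<cdot>\<^sub>v unit_vec n k"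
      unfolding y_def using Suc.prems by (intro eq_vecI) (auto simp: unit_vec_def less_Suc_eq)
    then have "N (y (Suc k)) \<le> N (y k) + N (vec_index x k \<cdot>\<^sub>v unit_vec n k)"
      using vec_norm_triangle[of "y k"] by (simp add: y_def)
    also have "\<dots> = N (y k) + \<bar>vec_index x k\<bar> * N (unit_vec n k)"
      by (simp add: vec_norm_smult)
    finally show ?case using Suc by simp
  qed
  moreover have "y n = x" unfolding y_def using x by auto
  ultimately show ?thesis by (metis order_refl)
qed

text \<open>Composing with \<open>vec n\<close> moves the norm to functions on the naturals with the
  product topology, where Tychonoff supplies compact sets. By the reverse triangle inequality the
  change of the norm is at most a finite weighted sum of coordinate changes, each of which tends to
  0.\<close>

lemma continuous_vec_norm: "continuous_on UNIV (\<lambda>f. N (vec n f))"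
  unfolding continuous_on_def
proof
  fix f :: "nat \<Rightarrow> real"
  have coord: "((\<lambda>g. g i) \<longlongrightarrow> f i) (at f)" for i :: nat
    using continuous_on_product_coordinates[of i] unfolding continuous_on_def by auto
  have "((\<lambda>g. \<Sum>i<n. \<bar>g i - f i\<bar> * N (unit_vec n i)) \<longlongrightarrow> (\<Sum>i<n. \<bar>f i - f i\<bar> * N (unit_vec n i))) (at f)"
    by (intro tendsto_intros coord)
  then have lim: "((\<lambda>g. \<Sum>i<n. \<bar>g i - f i\<bar> * N (unit_vec n i)) \<longlongrightarrow> 0) (at f)"
    by simp
  have bound: "\<bar>N (vec n g) - N (vec n f)\<bar> \<le> (\<Sum>i<n. \<bar>g i - f i\<bar> * N (unit_vec n i))" for g
    using vec_norm_reverse_triangle[of "vec n g" "vec n f"]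
      vec_norm_le_sum_units[of "vec n g - vec n f"] by simp
  show "((\<lambda>g. N (vec n g)) \<longlongrightarrow> N (vec n f)) (at f)"
    by (rule Lim_transform[OF _ Lim_null_comparison[OF _ lim], OF tendsto_const])
      (simp add: bound abs_minus_commute)
qed

text \<open>The face is compact and avoids the zero vector, so the continuous norm attains a
  positive minimum on it. The bound on \<open>f k\<close> ranges over all naturals, also beyond
  \<open>n\<close>, so that the face is a full product of compact sets.\<close>

lemma vec_norm_cube_face_bound:
  assumes i: "i < n"
  shows "\<exists>m>0. \<forall>f. f i = 1 \<and> (\<forall>k. \<bar>f k\<bar> \<le> 1) \<longrightarrow> m \<le> N (vec n f)"
proof -
  define S :: "nat \<Rightarrow> real set" where "S k = (if k = i then {1} else {-1..1})" for k
  have comp: "compact (PiE UNIV S)"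
    \<comment> \<open>Tychonoff; \<open>euclidean_product_topology\<close> identifies the product
      topology with the topology of the function type.\<close>
    using compactin_PiE[of "\<lambda>_. euclidean" UNIV S]
    by (auto simp: euclidean_product_topology S_def)
  have "(\<lambda>_. 1) \<in> PiE UNIV S" by (auto simp: S_def)
  then have ne: "PiE UNIV S \<noteq> {}" by blast
  have cont: "continuous_on (PiE UNIV S) (\<lambda>f. N (vec n f))"
    by (rule continuous_on_subset[OF continuous_vec_norm]) simp
  obtain f where f: "f \<in> PiE UNIV S"
    and min: "\<And>g. g \<in> PiE UNIV S \<Longrightarrow> N (vec n f) \<le> N (vec n g)"
    using continuous_attains_inf[OF comp ne cont] by blast
  have "f i \<in> S i" using f by (rule PiE_mem) simp
  then have "vec_index (vec n f) i = 1" using i by (simp add: S_def)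
  then have "vec n f \<noteq> 0\<^sub>v n" using i by (metis index_zero_vec(1) zero_neq_one)
  then have "0 < N (vec n f)"
    using vec_norm_nonneg[of "vec n f"] vec_norm_eq_0_iff[of "vec n f"] by (simp add: order_less_le)
  moreover have "g \<in> PiE UNIV S" if "g i = 1 \<and> (\<forall>k. \<bar>g k\<bar> \<le> 1)" for g
    using that by (auto simp: S_def abs_le_iff minus_le_iff)
  ultimately show ?thesis using min by blast
qed

text \<open>A nonzero vector divided by its entry of largest modulus lies on one of the cube faces,
  where the norm is bounded below; homogeneity then bounds that entry, and hence all
  entries.\<close>

lemma vec_norm_bounds_coordinates:
  "\<exists>C\<ge>0. \<forall>x\<in>carrier_vec n. \<forall>i<n. \<bar>vec_index x i\<bar> \<le> C * N x"
proof -
  obtain m where m: "\<And>i. i < n \<Longrightarrow> 0 < m i"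
    "\<And>i f. \<lbrakk>i < n; f i = 1; \<forall>k. \<bar>f k\<bar> \<le> 1\<rbrakk> \<Longrightarrow> m i \<le> N (vec n f)"
    using vec_norm_cube_face_bound by metis
  \<comment> \<open>Face \<open>i\<close> alone gives the constant \<open>1 / m i\<close>. The sum
    dominates all of them at once and makes sense for \<open>n = 0\<close> too.\<close>
  define C where "C = (\<Sum>i<n. 1 / m i)"
  have "\<bar>vec_index x k\<bar> \<le> C * N x" if x: "x \<in> carrier_vec n" and k: "k < n" for x k
  proof -
    let ?X = "(\<lambda>l. \<bar>vec_index x l\<bar>) ` {..<n}"
    have "Max ?X \<in> ?X" using k by (intro Max_in) auto
    then obtain i where "i < n" "Max ?X = \<bar>vec_index x i\<bar>" by auto
    moreover have "\<bar>vec_index x l\<bar> \<le> Max ?X" if "l < n" for l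
      using that by (intro Max_ge) auto
    ultimately have i: "i < n" "\<And>l. l < n \<Longrightarrow> \<bar>vec_index x l\<bar> \<le> \<bar>vec_index x i\<bar>"
      by auto
    show ?thesis
    proof (cases "vec_index x i = 0")
      case True
      then have "\<bar>vec_index x k\<bar> \<le> 0" using i(2)[OF k] by simp
      moreover have "0 \<le> C * N x"
        unfolding C_def using m(1) vec_norm_nonneg[OF x]
        by (intro mult_nonneg_nonneg sum_nonneg) (auto intro: less_imp_le)
      ultimately show ?thesis by linarith
    next
      case False
      \<comment> \<open>Extension by 0 keeps the modulus at most 1 beyond \<open>n\<close>, as the
        face bound demands.\<close>
      define f where "f l = (if l < n then vec_index x l / vec_index x i else 0)" for l
      have "f i = 1" using False i(1) by (simp add: f_def)
      moreover have "\<bar>f l\<bar> \<le> 1" for l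
        using False i(2)[of l] by (simp add: f_def divide_le_eq)
      ultimately have "m i \<le> N (vec n f)" using m(2) i(1) by blast
      moreover have "x = vec_index x i \<cdot>\<^sub>v vec n f"
        using False x by (intro eq_vecI) (auto simp: f_def)
      then have "N x = \<bar>vec_index x i\<bar> * N (vec n f)"
        using vec_norm_smult[of "vec n f" "vec_index x i"] by simp
      ultimately have "\<bar>vec_index x i\<bar> * m i \<le> N x"
        by (simp add: mult_left_mono)
      then have "\<bar>vec_index x i\<bar> \<le> 1 / m i * N x"
        using m(1)[OF i(1)] by (simp add: field_simps)
      also have "1 / m i \<le> C"
        unfolding C_def using i(1) m(1)
        by (intro member_le_sum) (auto intro: less_imp_le)
      then have "1 / m i * N x \<le> C * N x"
        using vec_norm_nonneg[OF x] by (rule mult_right_mono)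
      finally show ?thesis using i(2)[OF k] by linarith
    qed
  qed
  moreover have "0 \<le> C"
    unfolding C_def using m(1) by (intro sum_nonneg) (auto intro: less_imp_le)
  ultimately show ?thesis by blast
qed

section \<open>Operator norms\<close>

text \<open>A real \<open>Sup\<close> carries information only for a set bounded above. On the unit
  ball of \<open>N\<close> the coordinates are bounded, hence so are the coordinates of the image,
  and the expansion in unit vectors turns this back into a bound on \<open>N\<close>.\<close>

lemma op_norm_bdd_above:
  assumes A: "A \<in> carrier_mat n n"
  shows "bdd_above {N (A *\<^sub>v x) | x. x \<in> carrier_vec n \<and> N x \<le> 1}"
proof -
  obtain C where C: "0 \<le> C" "\<And>x i. \<lbrakk>x \<in> carrier_vec n; i < n\<rbrakk> \<Longrightarrow> \<bar>vec_index x i\<bar> \<le> C * N x"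
    using vec_norm_bounds_coordinates by blast
  define B where "B = (\<Sum>i<n. (\<Sum>k<n. \<bar>A $$ (i, k)\<bar> * C) * N (unit_vec n i))"
  have "N (A *\<^sub>v x) \<le> B" if x: "x \<in> carrier_vec n" and "N x \<le> 1" for x
  proof -
    have xk: "\<bar>vec_index x k\<bar> \<le> C" if "k < n" for k
      using C(2)[OF x that] mult_left_mono[OF \<open>N x \<le> 1\<close> C(1)] by simp
    have "\<bar>vec_index (A *\<^sub>v x) i\<bar> \<le> (\<Sum>k<n. \<bar>A $$ (i, k)\<bar> * C)" if "i < n" for i
    proof -
      have "vec_index (A *\<^sub>v x) i = (\<Sum>k<n. A $$ (i, k) * vec_index x k)"
        using that A x by (simp add: scalar_prod_def atLeast0LessThan)
      also have "\<bar>\<dots>\<bar> \<le> (\<Sum>k<n. \<bar>A $$ (i, k) * vec_index x k\<bar>)"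
        by (rule sum_abs)
      also have "\<dots> \<le> (\<Sum>k<n. \<bar>A $$ (i, k)\<bar> * C)"
        using xk by (intro sum_mono) (simp add: abs_mult mult_left_mono)
      finally show ?thesis .
    qed
    then have "(\<Sum>i<n. \<bar>vec_index (A *\<^sub>v x) i\<bar> * N (unit_vec n i)) \<le> B"
      unfolding B_def by (intro sum_mono mult_right_mono vec_norm_nonneg) auto
    then show ?thesis
      using vec_norm_le_sum_units[of "A *\<^sub>v x"] A x by (meson mult_mat_vec_carrier order_trans)
  qed
  then show ?thesis by (intro bdd_aboveI[of _ B]) auto
qed

section \<open>Algebraic properties of the operator norm\<close>

lemma op_norm_upper:
  assumes "A \<in> carrier_mat n n" "x \<in> carrier_vec n" "N x \<le> 1"
  shows "N (A *\<^sub>v x) \<le> op_norm n N A"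
  unfolding op_norm_def by (rule cSup_upper[OF _ op_norm_bdd_above]) (use assms in auto)

lemma op_norm_least:
  assumes "\<And>x. \<lbrakk>x \<in> carrier_vec n; N x \<le> 1\<rbrakk> \<Longrightarrow> N (A *\<^sub>v x) \<le> B"
  shows "op_norm n N A \<le> B"
  unfolding op_norm_def
proof (rule cSup_least)
  have "N (0\<^sub>v n) \<le> 1" using vec_norm_eq_0_iff[of "0\<^sub>v n"] by simp
  then show "{N (A *\<^sub>v x) | x. x \<in> carrier_vec n \<and> N x \<le> 1} \<noteq> {}"
    using zero_carrier_vec[of n] by blast
qed (use assms in auto)

lemma op_norm_nonneg:
  assumes A: "A \<in> carrier_mat n n"
  shows "0 \<le> op_norm n N A"
proof -
  have "0 \<le> N (A *\<^sub>v 0\<^sub>v n)" using A by (intro vec_norm_nonneg) auto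
  also have "\<dots> \<le> op_norm n N A"
    using vec_norm_eq_0_iff[of "0\<^sub>v n"] by (intro op_norm_upper A) auto
  finally show ?thesis .
qed

text \<open>The supremum tests only the unit ball, so \<open>x\<close> is rescaled to norm 1. If
  \<open>N x = 0\<close>, definiteness makes \<open>x\<close> the zero vector and both sides
  vanish.\<close>

lemma vec_norm_mult_le_op_norm:
  assumes A: "A \<in> carrier_mat n n" and x: "x \<in> carrier_vec n"
  shows "N (A *\<^sub>v x) \<le> op_norm n N A * N x"
proof (cases "N x = 0")
  case True
  then have "A *\<^sub>v x = 0\<^sub>v n" using A vec_norm_eq_0_iff[OF x] by auto
  then show ?thesis using True vec_norm_eq_0_iff[of "0\<^sub>v n"] by simp
next
  case False
  define y where "y = (1 / N x) \<cdot>\<^sub>v x"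
  have pos: "0 < N x" using False vec_norm_nonneg[OF x] by simp
  have y: "y \<in> carrier_vec n" using x by (simp add: y_def)
  have "N y = 1" using pos vec_norm_smult[OF x] by (simp add: y_def)
  then have "N (A *\<^sub>v y) \<le> op_norm n N A" using op_norm_upper[OF A y] by simp
  moreover have "A *\<^sub>v y = (1 / N x) \<cdot>\<^sub>v (A *\<^sub>v x)"
    unfolding y_def using A x by (rule mult_mat_vec)
  then have "N (A *\<^sub>v y) = N (A *\<^sub>v x) / N x"
    using vec_norm_smult[of "A *\<^sub>v x" "1 / N x"] A x pos by simp
  ultimately show ?thesis using pos by (simp add: divide_le_eq)
qed

lemma op_norm_mult:
  assumes A: "A \<in> carrier_mat n n" and B: "B \<in> carrier_mat n n"
  shows "op_norm n N (A * B) \<le> op_norm n N A * op_norm n N B"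
proof (rule op_norm_least)
  fix x assume x: "x \<in> carrier_vec n" "N x \<le> 1"
  have "N (A * B *\<^sub>v x) = N (A *\<^sub>v (B *\<^sub>v x))"
    using A B x by simp
  also have "\<dots> \<le> op_norm n N A * N (B *\<^sub>v x)"
    using A B x by (intro vec_norm_mult_le_op_norm) auto
  also have "\<dots> \<le> op_norm n N A * op_norm n N B"
    using op_norm_upper[OF B x] op_norm_nonneg[OF A] by (rule mult_left_mono)
  finally show "N (A * B *\<^sub>v x) \<le> op_norm n N A * op_norm n N B" .
qed

lemma op_norm_add:
  assumes A: "A \<in> carrier_mat n n" and B: "B \<in> carrier_mat n n"
  shows "op_norm n N (A + B) \<le> op_norm n N A + op_norm n N B"
proof (rule op_norm_least)
  fix x assume x: "x \<in> carrier_vec n" "N x \<le> 1"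
  have "N ((A + B) *\<^sub>v x) = N (A *\<^sub>v x + B *\<^sub>v x)"
    using A B x by (simp add: add_mult_distrib_mat_vec)
  also have "\<dots> \<le> N (A *\<^sub>v x) + N (B *\<^sub>v x)"
    using A B x by (intro vec_norm_triangle) auto
  also have "\<dots> \<le> op_norm n N A + op_norm n N B"
    using op_norm_upper[OF A x] op_norm_upper[OF B x] by linarith
  finally show "N ((A + B) *\<^sub>v x) \<le> op_norm n N A + op_norm n N B" .
qed

lemma op_norm_smult_le:
  assumes A: "A \<in> carrier_mat n n"
  shows "op_norm n N (c \<cdot>\<^sub>m A) \<le> \<bar>c\<bar> * op_norm n N A"
proof (rule op_norm_least)
  fix x assume x: "x \<in> carrier_vec n" "N x \<le> 1"
  have "(c \<cdot>\<^sub>m A) *\<^sub>v x = c \<cdot>\<^sub>v (A *\<^sub>v x)"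
    using A x by (intro eq_vecI) simp_all
  then have "N ((c \<cdot>\<^sub>m A) *\<^sub>v x) = \<bar>c\<bar> * N (A *\<^sub>v x)"
    using A x by (simp add: vec_norm_smult)
  also have "\<dots> \<le> \<bar>c\<bar> * op_norm n N A"
    using op_norm_upper[OF A x] by (simp add: mult_left_mono)
  finally show "N ((c \<cdot>\<^sub>m A) *\<^sub>v x) \<le> \<bar>c\<bar> * op_norm n N A" .
qed

text \<open>An inequality, since in dimension 0 the identity has norm 0.\<close>

lemma op_norm_one_le: "op_norm n N (1\<^sub>m n) \<le> 1"
  by (rule op_norm_least) simp

end

section \<open>The preconditioned stage operator\<close>

text \<open>The Gauss-Jordan computation is not unfolded: an explicit inverse makes the matrix a
  unit, so the algorithm returns some \<open>X\<close>, and
  \<open>c \<cdot>\<^sub>m X = 1\<^sub>m n\<close> determines \<open>X\<close>.\<close>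

lemma mat_inverse_smult_one:
  fixes c :: "'a :: field"
  assumes "c \<noteq> 0"
  shows "mat_inverse (c \<cdot>\<^sub>m 1\<^sub>m n) = Some (inverse c \<cdot>\<^sub>m 1\<^sub>m n)"
proof -
  let ?A = "c \<cdot>\<^sub>m 1\<^sub>m n" and ?B = "inverse c \<cdot>\<^sub>m 1\<^sub>m n :: 'a mat"
  have A: "?A \<in> carrier_mat n n" and B: "?B \<in> carrier_mat n n" by auto
  have smult: "(a \<cdot>\<^sub>m 1\<^sub>m n) * X = a \<cdot>\<^sub>m X" if "X \<in> carrier_mat n n" for a :: 'a and X
    using that mult_smult_assoc_mat[of "1\<^sub>m n" n n X n a] by simp
  have AB: "?A * ?B = 1\<^sub>m n" and BA: "?B * ?A = 1\<^sub>m n"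
    using smult[OF A] smult[OF B] assms by (auto simp: field_simps)
  \<comment> \<open>The matrix ring is a record whose extension slot may hold any value, here
    \<open>undefined\<close>.\<close>
  have "?A \<in> Units (ring_mat TYPE('a) n undefined)"
    using A B AB BA unfolding Units_def ring_mat_def by auto
  then obtain X where X: "mat_inverse ?A = Some X"
    using mat_inverse(1)[OF A] by fastforce
  then have "?A * X = 1\<^sub>m n" and Xc: "X \<in> carrier_mat n n"
    using mat_inverse(2)[OF A] by blast+
  then have "c \<cdot>\<^sub>m X = 1\<^sub>m n" using smult[OF Xc] by simp
  moreover have "X = inverse c \<cdot>\<^sub>m (c \<cdot>\<^sub>m X)" using Xc assms by (intro eq_matI) auto
  ultimately have "X = ?B" by simp
  then show ?thesis using X by simp
qed

lemma inverse_smult_shifted_mat: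
  fixes c g :: "'a :: field"
  assumes "A \<in> carrier_mat n n" "c \<noteq> 0"
  shows "inverse c \<cdot>\<^sub>m (c \<cdot>\<^sub>m 1\<^sub>m n - g \<cdot>\<^sub>m A) = 1\<^sub>m n - (g / c) \<cdot>\<^sub>m A"
  using assms by (intro eq_matI) (auto simp: field_simps)

lemma one_minus_smult_minus_one:
  fixes t :: "'a :: comm_ring_1"
  assumes "A \<in> carrier_mat n n"
  shows "1\<^sub>m n - t \<cdot>\<^sub>m A - 1\<^sub>m n = (- t) \<cdot>\<^sub>m A"
  using assms by (intro eq_matI) auto

section \<open>Sign and size of the stage coefficients\<close>

lemma stage_c_pos:
  assumes "0 < h" "0 < \<epsilon>"
  shows "0 < stage_c j h \<epsilon>"
  unfolding stage_c_def stage_alpha_def stage_beta_def using assms by (auto intro!: add_pos_pos)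

lemma stage_theta_eq: "stage_theta j h \<epsilon> = stage_gamma j h \<epsilon> / stage_c j h \<epsilon>"
  by (simp add: stage_theta_def stage_gamma_def stage_c_def)

lemma stage_theta_nonneg:
  assumes "0 < h" "0 < \<epsilon>"
  shows "0 \<le> stage_theta j h \<epsilon>"
  unfolding stage_theta_eq using stage_c_pos[OF assms, of j] assms
  by (simp add: stage_gamma_def stage_beta_def)

lemma stage_theta_le:
  assumes "0 < h" "0 < \<epsilon>"
  shows "stage_theta j h \<epsilon> \<le> \<epsilon>"
proof -
  \<comment> \<open>The factor in parentheses is the last summand of \<open>stage_c\<close>, whose
    other summands are nonnegative. The ratio of \<open>stage_theta\<close> to \<epsilon> tends to 1
    as h / \<epsilon> grows, so the constant 1 in the bound is optimal.\<close>
  have "stage_gamma j h \<epsilon> = \<epsilon> * (stage_beta j * h\<^sup>2 / \<epsilon>\<^sup>2)"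
    using assms by (simp add: stage_gamma_def power2_eq_square)
  also have "\<dots> \<le> \<epsilon> * stage_c j h \<epsilon>"
    using assms unfolding stage_c_def stage_alpha_def by (intro mult_left_mono) auto
  finally show ?thesis
    unfolding stage_theta_eq using stage_c_pos[OF assms, of j] by (simp add: divide_le_eq)
qed

section \<open>Matrix form of the preconditioned operator\<close>

lemma diag_of_carrier [simp]: "w \<in> carrier_vec n \<Longrightarrow> diag_of w \<in> carrier_mat n n"
  by (auto simp: diag_of_def mat_diag_def)

lemma dflux_carrier [simp]: "u \<in> carrier_vec n \<Longrightarrow> dflux u \<in> carrier_vec n"
  by (simp add: dflux_def)

lemma diag_dflux_mult_carrier:
  assumes "stage_data n h \<epsilon> u D"
  shows "diag_of (dflux u) * D \<in> carrier_mat n n"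
  using assms unfolding stage_data_def by (intro mult_carrier_mat[of _ n n]) auto

text \<open>Certifies that \<open>the (mat_inverse ...)\<close> in \<open>stage_PM\<close> stands
  for a true inverse.\<close>

lemma invertible_stage_P:
  assumes "0 < h" "0 < \<epsilon>"
  shows "invertible_mat (stage_P j n h \<epsilon>)"
proof -
  have P: "stage_P j n h \<epsilon> \<in> carrier_mat n n" by (simp add: stage_P_def)
  obtain B where "mat_inverse (stage_P j n h \<epsilon>) = Some B"
    using mat_inverse_smult_one stage_c_pos[OF assms, of j] unfolding stage_P_def
    by (metis less_irrefl)
  from mat_inverse(2)[OF P this] show ?thesis
    using P unfolding invertible_mat_def inverts_mat_def square_mat.simps by auto
qed

lemma stage_PM_eq:
  assumes "stage_data n h \<epsilon> u D"
  shows "stage_PM j n h \<epsilon> u D = 1\<^sub>m n - stage_theta j h \<epsilon> \<cdot>\<^sub>m (diag_of (dflux u) * D)"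
proof -
  let ?c = "stage_c j h \<epsilon>" and ?A = "diag_of (dflux u) * D"
  have c: "0 < ?c" using assms stage_c_pos[of h \<epsilon> j] by (simp add: stage_data_def)
  note A = diag_dflux_mult_carrier[OF assms]
  have M: "stage_M j n h \<epsilon> u D \<in> carrier_mat n n"
    unfolding stage_M_def by (rule minus_carrier_mat) (use A in auto)
  have "stage_PM j n h \<epsilon> u D = inverse ?c \<cdot>\<^sub>m 1\<^sub>m n * stage_M j n h \<epsilon> u D"
    using c by (simp add: stage_PM_def stage_P_def mat_inverse_smult_one)
  also have "\<dots> = inverse ?c \<cdot>\<^sub>m stage_M j n h \<epsilon> u D"
    using M mult_smult_assoc_mat[of "1\<^sub>m n" n n "stage_M j n h \<epsilon> u D" n "inverse ?c"] by simp
  also have "\<dots> = 1\<^sub>m n - stage_theta j h \<epsilon> \<cdot>\<^sub>m ?A"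
    unfolding stage_M_def stage_theta_eq using c by (intro inverse_smult_shifted_mat[OF A]) simp
  finally show ?thesis .
qed

lemma stage_PM_minus_one:
  assumes "stage_data n h \<epsilon> u D"
  shows "stage_PM j n h \<epsilon> u D - 1\<^sub>m n = (- stage_theta j h \<epsilon>) \<cdot>\<^sub>m (diag_of (dflux u) * D)"
  unfolding stage_PM_eq[OF assms]
  by (rule one_minus_smult_minus_one[OF diag_dflux_mult_carrier[OF assms]])

section \<open>Norm estimates for the preconditioned operator\<close>

lemma derivative_bound_nonneg:
  assumes "stage_data n h \<epsilon> u D" "diag_compatible_norm n N" "derivative_bound C n N dx D"
  shows "0 \<le> C"
proof -
  \<comment> \<open>The sign of \<open>C\<close> is not assumed; it is forced because C / dx
    dominates a nonnegative operator norm.\<close>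
  have "0 \<le> op_norm n N D"
    using assms op_norm_nonneg unfolding stage_data_def diag_compatible_norm_def by blast
  then have "0 \<le> C / dx" "0 < dx"
    using assms(3) unfolding derivative_bound_def by auto
  then show ?thesis by (simp add: zero_le_divide_iff)
qed

lemma op_norm_stage_PM_minus_one:
  assumes data: "stage_data n h \<epsilon> u D"
    and N: "diag_compatible_norm n N"
    and D: "derivative_bound C n N dx D"
  shows "op_norm n N (stage_PM j n h \<epsilon> u D - 1\<^sub>m n) \<le> C * sup_norm (dflux u) * (\<epsilon> / dx)"
proof -
  let ?W = "diag_of (dflux u)" and ?s = "sup_norm (dflux u)" and ?\<theta> = "stage_theta j h \<epsilon>"
  have norm: "is_vec_norm n N" using N by (simp add: diag_compatible_norm_def)
  have pos: "0 < h" "0 < \<epsilon>" and W: "?W \<in> carrier_mat n n" and Dc: "D \<in> carrier_mat n n"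
    and w: "dflux u \<in> carrier_vec n"
    using data by (auto simp: stage_data_def)
  have Ws: "op_norm n N ?W \<le> ?s" using N w by (simp add: diag_compatible_norm_def)
  have Db: "op_norm n N D \<le> C / dx" using D by (simp add: derivative_bound_def)
  have "op_norm n N (?W * D) \<le> op_norm n N ?W * op_norm n N D"
    by (rule op_norm_mult[OF norm W Dc])
  \<comment> \<open>Monotonicity of the product requires \<open>?s\<close> to be nonnegative, which
    follows from \<open>Ws\<close> because \<open>?s\<close> dominates an operator norm.\<close>
  also have "\<dots> \<le> ?s * (C / dx)"
    using Ws Db op_norm_nonneg[OF norm W] op_norm_nonneg[OF norm Dc] by (intro mult_mono) auto
  finally have WD: "op_norm n N (?W * D) \<le> ?s * (C / dx)" .
  have WDc: "?W * D \<in> carrier_mat n n" using W Dc by simp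
  have "op_norm n N (stage_PM j n h \<epsilon> u D - 1\<^sub>m n) \<le> ?\<theta> * op_norm n N (?W * D)"
    using op_norm_smult_le[OF norm WDc, of "- ?\<theta>"] stage_theta_nonneg[OF pos, of j]
    by (simp add: stage_PM_minus_one[OF data])
  also have "\<dots> \<le> \<epsilon> * (?s * (C / dx))"
    using stage_theta_le[OF pos, of j] WD pos op_norm_nonneg[OF norm WDc]
    by (intro mult_mono) auto
  finally show ?thesis by (simp add: ac_simps)
qed

lemma op_norm_stage_PM_minus_one_uniform:
  assumes data: "stage_data n h \<epsilon> u D"
    and N: "diag_compatible_norm n N"
    and D: "derivative_bound C n N dx D"
    and L: "sup_norm (dflux u) \<le> L"
  shows "op_norm n N (stage_PM j n h \<epsilon> u D - 1\<^sub>m n) \<le> C * L * (\<epsilon> / dx)"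
proof -
  have "0 \<le> \<epsilon> / dx" using data D by (simp add: stage_data_def derivative_bound_def)
  then have "C * sup_norm (dflux u) * (\<epsilon> / dx) \<le> C * L * (\<epsilon> / dx)"
    using L derivative_bound_nonneg[OF data N D] by (intro mult_right_mono mult_left_mono)
  then show ?thesis using op_norm_stage_PM_minus_one[OF data N D, of j] by linarith
qed

text \<open>The operator is split as the identity plus its deviation. The resulting bound involves
  only \<open>C\<close>, \<open>L\<close> and \<open>K\<close>, so it is uniform in grid, norm, step
  sizes and grid function.\<close>

lemma op_norm_stage_PM_le:
  assumes data: "stage_data n h \<epsilon> u D"
    and N: "diag_compatible_norm n N"
    and D: "derivative_bound C n N dx D"
    and L: "sup_norm (dflux u) \<le> L"
    and K: "\<epsilon> / dx \<le> K"
  shows "op_norm n N (stage_PM j n h \<epsilon> u D) \<le> 1 + C * L * K"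
proof -
  let ?X = "stage_PM j n h \<epsilon> u D"
  have norm: "is_vec_norm n N" using N by (simp add: diag_compatible_norm_def)
  have W: "diag_of (dflux u) \<in> carrier_mat n n"
    using data by (auto simp: stage_data_def)
  have X: "?X \<in> carrier_mat n n"
    unfolding stage_PM_eq[OF data]
    by (intro minus_carrier_mat smult_carrier_mat diag_dflux_mult_carrier[OF data])
  \<comment> \<open>A matrix difference takes its dimensions from the subtrahend.\<close>
  have Y: "?X - 1\<^sub>m n \<in> carrier_mat n n" by (rule minus_carrier_mat) simp
  have "?X = 1\<^sub>m n + (?X - 1\<^sub>m n)" using X by (intro eq_matI) auto
  then have "op_norm n N ?X \<le> op_norm n N (1\<^sub>m n) + op_norm n N (?X - 1\<^sub>m n)"
    using op_norm_add[OF norm one_carrier_mat Y] by simp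
  also have "\<dots> \<le> 1 + C * L * (\<epsilon> / dx)"
    using op_norm_one_le[OF norm] op_norm_stage_PM_minus_one_uniform[OF data N D L]
    by (intro add_mono)
  also have "\<dots> \<le> 1 + C * L * K"
  proof -
    \<comment> \<open>Replacing \<epsilon> / dx by \<open>K\<close> needs \<open>C * L\<close>
      nonnegative; \<open>L\<close> is so because it lies above \<open>sup_norm (dflux u)\<close>,
      which dominates an operator norm.\<close>
    have "0 \<le> op_norm n N (diag_of (dflux u))" by (rule op_norm_nonneg[OF norm W])
    also have "\<dots> \<le> sup_norm (dflux u)"
      using N data by (simp add: diag_compatible_norm_def stage_data_def)
    finally have "0 \<le> C * L"
      using L derivative_bound_nonneg[OF data N D] by simp
    then show ?thesis using mult_left_mono[OF K, of "C * L"] by simp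
  qed
  finally show ?thesis .
qed

text \<open>In the uniform bound \<open>B\<close> is chosen before grid, norm and step sizes, so it
  depends only on the stage and the three constants. Convergence is stated along an arbitrary
  filter, with dimension and norm varying along the family, so that grid refinement is
  covered.\<close>

theorem theorem7p4:
  fixes j :: nat
    and F :: "'i filter"
  assumes "j \<in> {1, 2}"
  shows
    "(\<forall>n h \<epsilon> u D. stage_data n h \<epsilon> u D \<longrightarrow>
        invertible_mat (stage_P j n h \<epsilon>) \<and>
        stage_PM j n h \<epsilon> u D = 1\<^sub>m n - stage_theta j h \<epsilon> \<cdot>\<^sub>m (diag_of (dflux u) * D) \<and>
        0 \<le> stage_theta j h \<epsilon> \<and> stage_theta j h \<epsilon> \<le> \<epsilon> \<and>
        (\<forall>N \<Delta>x C\<^sub>D. diag_compatible_norm n N \<and> derivative_bound C\<^sub>D n N \<Delta>x D \<longrightarrow>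
           op_norm n N (stage_PM j n h \<epsilon> u D - 1\<^sub>m n)
             \<le> C\<^sub>D * sup_norm (dflux u) * (\<epsilon> / \<Delta>x))) \<and>
     (\<forall>C\<^sub>D L K. \<exists>B. \<forall>n N h \<epsilon> \<Delta>x u D.
        stage_data n h \<epsilon> u D \<and> diag_compatible_norm n N \<and> derivative_bound C\<^sub>D n N \<Delta>x D \<and>
        sup_norm (dflux u) \<le> L \<and> \<epsilon> / \<Delta>x \<le> K \<longrightarrow>
        op_norm n N (stage_PM j n h \<epsilon> u D) \<le> B) \<and>
     (\<forall>C\<^sub>D L (n :: 'i \<Rightarrow> nat) N h \<epsilon> \<Delta>x u D.
        (\<forall>i. stage_data (n i) (h i) (\<epsilon> i) (u i) (D i) \<and>
             diag_compatible_norm (n i) (N i) \<and> derivative_bound C\<^sub>D (n i) (N i) (\<Delta>x i) (D i) \<and>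
             sup_norm (dflux (u i)) \<le> L) \<and>
        ((\<lambda>i. \<epsilon> i / \<Delta>x i) \<longlongrightarrow> 0) F \<longrightarrow>
        ((\<lambda>i. op_norm (n i) (N i)
                (stage_PM j (n i) (h i) (\<epsilon> i) (u i) (D i) - 1\<^sub>m (n i))) \<longlongrightarrow> 0) F)"
proof (intro conjI allI impI)
  fix n h \<epsilon> u D
  assume data: "stage_data n h \<epsilon> u D"
  then have pos: "0 < h" "0 < \<epsilon>" by (auto simp: stage_data_def)
  show "invertible_mat (stage_P j n h \<epsilon>)" by (rule invertible_stage_P[OF pos])
  show "stage_PM j n h \<epsilon> u D = 1\<^sub>m n - stage_theta j h \<epsilon> \<cdot>\<^sub>m (diag_of (dflux u) * D)"
    by (rule stage_PM_eq[OF data])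
  show "0 \<le> stage_theta j h \<epsilon>" by (rule stage_theta_nonneg[OF pos])
  show "stage_theta j h \<epsilon> \<le> \<epsilon>" by (rule stage_theta_le[OF pos])
  fix N \<Delta>x C\<^sub>D
  assume "diag_compatible_norm n N \<and> derivative_bound C\<^sub>D n N \<Delta>x D"
  then show "op_norm n N (stage_PM j n h \<epsilon> u D - 1\<^sub>m n) \<le> C\<^sub>D * sup_norm (dflux u) * (\<epsilon> / \<Delta>x)"
    using op_norm_stage_PM_minus_one[OF data] by blast
next
  fix C\<^sub>D L K
  show "\<exists>B. \<forall>n N h \<epsilon> \<Delta>x u D.
        stage_data n h \<epsilon> u D \<and> diag_compatible_norm n N \<and> derivative_bound C\<^sub>D n N \<Delta>x D \<and>
        sup_norm (dflux u) \<le> L \<and> \<epsilon> / \<Delta>x \<le> K \<longrightarrow>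
        op_norm n N (stage_PM j n h \<epsilon> u D) \<le> B"
    using op_norm_stage_PM_le by (intro exI[of _ "1 + C\<^sub>D * L * K"]) blast
next
  fix C\<^sub>D L and n :: "'i \<Rightarrow> nat" and N h \<epsilon> \<Delta>x u D
  assume "(\<forall>i. stage_data (n i) (h i) (\<epsilon> i) (u i) (D i) \<and>
             diag_compatible_norm (n i) (N i) \<and> derivative_bound C\<^sub>D (n i) (N i) (\<Delta>x i) (D i) \<and>
             sup_norm (dflux (u i)) \<le> L) \<and>
        ((\<lambda>i. \<epsilon> i / \<Delta>x i) \<longlongrightarrow> 0) F"
  then have data: "stage_data (n i) (h i) (\<epsilon> i) (u i) (D i)"
    and N: "diag_compatible_norm (n i) (N i)"
    and D: "derivative_bound C\<^sub>D (n i) (N i) (\<Delta>x i) (D i)"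
    and L: "sup_norm (dflux (u i)) \<le> L"
    and lim: "((\<lambda>i. \<epsilon> i / \<Delta>x i) \<longlongrightarrow> 0) F" for i
    by blast+
  let ?e = "\<lambda>i. op_norm (n i) (N i) (stage_PM j (n i) (h i) (\<epsilon> i) (u i) (D i) - 1\<^sub>m (n i))"
  have lower: "0 \<le> ?e i" for i
    using N[of i] unfolding diag_compatible_norm_def
    by (intro op_norm_nonneg minus_carrier_mat) auto
  \<comment> \<open>Since \<open>C\<^sub>D\<close> and \<open>L\<close> are the same for all
    \<open>i\<close>, this majorant is a fixed multiple of a null family, and the squeeze
    applies.\<close>
  have upper: "?e i \<le> C\<^sub>D * L * (\<epsilon> i / \<Delta>x i)" for i
    by (rule op_norm_stage_PM_minus_one_uniform[OF data N D L])
  show "(?e \<longlongrightarrow> 0) F"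
  proof (rule tendsto_sandwich)
    show "((\<lambda>_. 0) \<longlongrightarrow> (0::real)) F" by simp
    show "((\<lambda>i. C\<^sub>D * L * (\<epsilon> i / \<Delta>x i)) \<longlongrightarrow> 0) F"
      by (rule tendsto_mult_right_zero[OF lim])
  qed (use lower upper in auto)
qed

end
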